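(* Let $N\ge 1$ be an integer and let $\omega(i)\in(0,1]$ for $1\le i\le N-1$ be an environment. Let $\omega'$ be the reflected environment, $\omega'(i)=\omega(N-i)$ for $1\le i\le N-1$. Then the expected hitting times of $N$ from $0$, for the walks on $\{0,1,\dots,N\}$ with reflection at the origin in the environments $\omega$ and $\omega'$, agree: $$E_{\omega'}^0(T_N)=E_\omega^0(T_N).$$
   Context: The walk in environment $\omega$ with reflection at the origin is the Markov chain $\{X_n\}_{n\ge0}$ on $\{0,1,\dots,N\}$ with $P(X_{n+1}=i+1\mid X_n=i)=\omega(i)$ and $P(X_{n+1}=i-1\mid X_n=i)=1-\omega(i)$ for $1\le i\le N-1$, and $P(X_{n+1}=1\mid X_n=0)=1$ (the behavior after reaching $N$ is irrelevant). $T_N=\min\{n\ge0\mid X_n=N\}$, and $E_\omega^0$ denotes expectation for the walk in environment $\omega$ started at $X_0=0$. *)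

theory Defs
  imports "HOL-Probability.Probability"
begin

definition markov_chain ::
    "('s \<Rightarrow> 's pmf) \<Rightarrow> 's \<Rightarrow> 'a measure \<Rightarrow> (nat \<Rightarrow> 'a \<Rightarrow> 's) \<Rightarrow> bool" where
  "markov_chain K s M X \<longleftrightarrow>
     prob_space M \<and>
     (\<forall>n. X n \<in> measurable M (count_space UNIV)) \<and>
     (AE w in M. X 0 w = s) \<and>
     (\<forall>n x j. \<P>(w in M. \<forall>k\<le>n. X k w = x k) > 0 \<longrightarrow>
        \<P>(w in M. X (Suc n) w = j \<bar> \<forall>k\<le>n. X k w = x k) = pmf (K (x n)) j)"

text \<open>The transition law at \<open>N\<close> is left arbitrary (within \<open>{0..N}\<close>); likewise \<open>\<omega>\<close> is
  only consulted on \<open>{1..<N}\<close>.\<close>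

definition walk_kernel :: "nat \<Rightarrow> (nat \<Rightarrow> real) \<Rightarrow> (nat \<Rightarrow> nat pmf) \<Rightarrow> bool" where
  "walk_kernel N \<omega> K \<longleftrightarrow>
     pmf (K 0) 1 = 1 \<and>
     (\<forall>i\<in>{1..<N}. pmf (K i) (i + 1) = \<omega> i \<and> pmf (K i) (i - 1) = 1 - \<omega> i) \<and>
     set_pmf (K N) \<subseteq> {0..N}"

definition origin_reflecting_walk ::
    "nat \<Rightarrow> (nat \<Rightarrow> real) \<Rightarrow> nat \<Rightarrow> 'a measure \<Rightarrow> (nat \<Rightarrow> 'a \<Rightarrow> nat) \<Rightarrow> bool" where
  "origin_reflecting_walk N \<omega> s M X \<longleftrightarrow> (\<exists>K. walk_kernel N \<omega> K \<and> markov_chain K s M X)"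

text \<open>The value is \<open>\<infinity>\<close> on paths that never reach \<open>s\<close>.\<close>

definition hitting_time :: "(nat \<Rightarrow> 'a \<Rightarrow> 's) \<Rightarrow> 's \<Rightarrow> 'a \<Rightarrow> enat" where
  "hitting_time X s w = (INF n\<in>{n. X n w = s}. enat n)"

definition expected_hitting_time ::
    "'a measure \<Rightarrow> (nat \<Rightarrow> 'a \<Rightarrow> 's) \<Rightarrow> 's \<Rightarrow> ennreal" where
  "expected_hitting_time M X s = (\<integral>\<^sup>+ w. ennreal_of_enat (hitting_time X s w) \<partial>M)"


text \<open>Such walks exist: take independent \<open>w (n, i)\<close> with law \<open>K i\<close>, where \<open>w (n, i)\<close> is the
  position after the step at time \<open>n\<close> if that step starts from \<open>i\<close>.\<close>

primrec driven :: "'s \<Rightarrow> nat \<Rightarrow> (nat \<times> 's \<Rightarrow> 's) \<Rightarrow> 's" where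
  "driven s 0 w = s"
| "driven s (Suc n) w = w (n, driven s n w)"

lemma markov_chain_driven:
  fixes K :: "'s::countable \<Rightarrow> 's pmf"
  shows "markov_chain K s (PiM UNIV (\<lambda>(n, i). measure_pmf (K i))) (driven s)"
proof -
  let ?F = "\<lambda>p::nat \<times> 's. measure_pmf (K (snd p))"
  let ?M = "PiM UNIV ?F"
  interpret product_prob_space ?F UNIV
    by unfold_locales
  have sp: "space ?M = UNIV"
    by (auto simp: space_PiM)
  have coord: "(\<lambda>w. w p) \<in> measurable ?M (count_space UNIV)" for p
    using measurable_component_singleton[of p UNIV ?F]
      measurable_cong_sets[of ?M ?M "?F p" "count_space UNIV"] by simp
  have meas: "driven s n \<in> measurable ?M (count_space UNIV)" for n
  proof (induction n)
    case (Suc n)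
    have "(\<lambda>w. (\<lambda>i w. w (n, i)) (driven s n w) w) \<in> measurable ?M (count_space UNIV)"
      by (rule measurable_compose_countable[OF coord Suc])
    then show ?case by (simp add: driven.simps(2)[abs_def])
  qed (simp add: driven.simps(1)[abs_def])
  have path: "(\<forall>k\<le>n. driven s k w = x k) \<longleftrightarrow>
      x 0 = s \<and> (\<forall>k<n. w (k, x k) = x (Suc k))" for n w x
    by (induction n) (auto simp: le_Suc_eq less_Suc_eq)
  have prob: "\<P>(w in ?M. \<forall>k\<le>n. driven s k w = x k) =
      (if x 0 = s then \<Prod>k<n. pmf (K (x k)) (x (Suc k)) else 0)" for n x
  proof (cases "x 0 = s")
    case True
    let ?J = "(\<lambda>k. (k, x k)) ` {..<n}"
    have "{w \<in> space ?M. \<forall>k\<le>n. driven s k w = x k} =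
        prod_emb UNIV ?F ?J (Pi\<^sub>E ?J (\<lambda>p. {x (Suc (fst p))}))"
      by (auto simp: path True prod_emb_def sp restrict_def PiE_iff)
    then have "\<P>(w in ?M. \<forall>k\<le>n. driven s k w = x k) =
        (\<Prod>p\<in>?J. measure (?F p) {x (Suc (fst p))})"
      by (simp add: measure_PiM_emb)
    also have "\<dots> = (\<Prod>k<n. pmf (K (x k)) (x (Suc k)))"
      by (subst prod.reindex) (auto simp: inj_on_def pmf.rep_eq)
    finally show ?thesis using True by simp
  qed (simp add: path)
  have "\<P>(w in ?M. driven s (Suc n) w = j \<bar> \<forall>k\<le>n. driven s k w = x k) = pmf (K (x n)) j"
    if pos: "\<P>(w in ?M. \<forall>k\<le>n. driven s k w = x k) > 0" for n x j
  proof -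
    have s: "x 0 = s" using pos by (auto simp: prob split: if_splits)
    have "(driven s (Suc n) w = j \<and> (\<forall>k\<le>n. driven s k w = x k)) \<longleftrightarrow>
        (\<forall>k\<le>Suc n. driven s k w = (x(Suc n := j)) k)" for w
      by (auto simp: le_Suc_eq simp del: driven.simps)
    then have "\<P>(w in ?M. driven s (Suc n) w = j \<and> (\<forall>k\<le>n. driven s k w = x k)) =
        (\<Prod>k<n. pmf (K (x k)) (x (Suc k))) * pmf (K (x n)) j"
      using s by (simp add: prob del: driven.simps)
    moreover have "(\<Prod>k<n. pmf (K (x k)) (x (Suc k))) \<noteq> 0"
      using pos unfolding prob if_P[OF s] by (rule less_imp_neq[THEN not_sym])
    ultimately show ?thesis
      using s unfolding cond_prob_def prob by simp
  qed
  then have "markov_chain K s ?M (driven s)"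
    unfolding markov_chain_def using meas prob_space_axioms by auto
  then show ?thesis by (simp add: case_prod_beta')
qed

lemma origin_reflecting_walk_exists:
  assumes "N \<ge> 1" "\<And>i. i \<in> {1..<N} \<Longrightarrow> 0 < \<omega> i \<and> \<omega> i \<le> 1"
  shows "\<exists>(M :: (nat \<times> nat \<Rightarrow> nat) measure) X. origin_reflecting_walk N \<omega> s M X"
proof -
  define K where "K i = (if i = 0 then return_pmf 1
    else if i < N then map_pmf (\<lambda>b. if b then i + 1 else i - 1) (bernoulli_pmf (\<omega> i))
    else return_pmf N)" for i
  have "pmf (K i) (i + 1) = \<omega> i" "pmf (K i) (i - 1) = 1 - \<omega> i" if "i \<in> {1..<N}" for i
  proof -
    let ?f = "\<lambda>b. if b then i + 1 else i - 1"
    have "inj ?f" by (auto simp: inj_def)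
    from pmf_map_inj'[OF this, of "bernoulli_pmf (\<omega> i)" True]
      pmf_map_inj'[OF this, of "bernoulli_pmf (\<omega> i)" False] that assms(2)[OF that]
    show "pmf (K i) (i + 1) = \<omega> i" "pmf (K i) (i - 1) = 1 - \<omega> i"
      by (auto simp: K_def)
  qed
  then have "walk_kernel N \<omega> K"
    using assms(1) by (auto simp: walk_kernel_def K_def)
  then show ?thesis
    using markov_chain_driven unfolding origin_reflecting_walk_def by blast
qed

end

theory Submission
  imports Defs
begin

text \<open>
  Let \<open>d i\<close> be the expected time to go from \<open>i\<close> to \<open>i + 1\<close>. Conditioning on the first step gives
  \<open>d 0 = 1\<close> and \<open>\<omega> i * d i = 1 + (1 - \<omega> i) * d (i - 1)\<close>, so with \<open>\<rho> l = (1 - \<omega> l) / \<omega> l\<close> the expected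
  hitting time of \<open>N\<close> from \<open>0\<close> is \<open>\<Sum>i<N. d i = N + 2 * (\<Sum>1\<le>j\<le>i<N. \<rho> j * \<dots> * \<rho> i)\<close>, which is invariant
  under \<open>l \<mapsto> N - l\<close>. That the sum of the \<open>d i\<close> really is the expectation follows from a martingale
  argument: with \<open>h i = d i + \<dots> + d (N - 1)\<close> and \<open>T\<close> the hitting time, \<open>V n = E[h (X n); T > n]\<close>
  decreases by \<open>P(T > n)\<close> in the \<open>n\<close>-th step. As \<open>V \<ge> 0\<close>, the probabilities \<open>P(T > n)\<close> are summable, hence
  tend to \<open>0\<close>, hence \<open>V\<close> tends to \<open>0\<close> as well and they sum to \<open>V 0 = h 0\<close>.\<close>

section \<open>The Markov property for events of the whole past\<close>

text \<open>\<open>markov_chain\<close> fixes transition probabilities only given one complete path.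
  There are countably many paths of a given length, so the event splits into disjoint path events,
  all sharing the factor \<open>pmf (K i) j\<close> because each path in \<open>S\<close> ends in
  \<open>i\<close>.\<close>

lemma markov_chain_step:
  fixes K :: "'s::countable \<Rightarrow> 's pmf" and X :: "nat \<Rightarrow> 'a \<Rightarrow> 's"
  assumes mc: "markov_chain K s M X"
  shows "measure M {w \<in> space M. X (Suc n) w = j \<and> X n w = i \<and> Q (map (\<lambda>k. X k w) [0..<Suc n])} =
    measure M {w \<in> space M. X n w = i \<and> Q (map (\<lambda>k. X k w) [0..<Suc n])} * pmf (K i) j"
proof -
  interpret prob_space M using mc by (simp add: markov_chain_def)
  have X[measurable]: "X n \<in> measurable M (count_space UNIV)" for n
    using mc by (simp add: markov_chain_def)
  define L where "L w = map (\<lambda>k. X k w) [0..<Suc n]" for w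
  define S where "S = {l. length l = Suc n \<and> l ! n = i \<and> Q l}"
  have L_eq: "L w = l \<longleftrightarrow> (\<forall>k\<le>n. X k w = l ! k)" if "length l = Suc n" for l w
    using that by (auto simp: L_def list_eq_iff_nth_eq less_Suc_eq_le simp del: upt_Suc)
  have L_S: "L w \<in> S \<longleftrightarrow> X n w = i \<and> Q (L w)" for w
    by (simp add: S_def L_def nth_append)
  have meas[measurable]: "{w \<in> space M. L w = l} \<in> sets M" if "l \<in> S" for l
    using that by (simp add: S_def L_eq)
  have step_meas[measurable]: "{w \<in> space M. X (Suc n) w = j \<and> L w = l} \<in> sets M" if "l \<in> S" for l
    using that by (simp add: S_def L_eq)
  have one: "emeasure M {w \<in> space M. X (Suc n) w = j \<and> L w = l} =
      emeasure M {w \<in> space M. L w = l} * ennreal (pmf (K i) j)" if "l \<in> S" for l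
  proof -
    from that have l: "length l = Suc n" "l ! n = i" by (auto simp: S_def)
    have "prob {w \<in> space M. X (Suc n) w = j \<and> L w = l} =
      prob {w \<in> space M. L w = l} * pmf (K i) j"
    proof (cases "prob {w \<in> space M. L w = l} > 0")
      case True
      then have "\<P>(w in M. X (Suc n) w = j \<bar> \<forall>k\<le>n. X k w = l ! k) = pmf (K (l ! n)) j"
        using mc unfolding markov_chain_def L_eq[OF l(1)] by blast
      then show ?thesis
        using True unfolding cond_prob_def L_eq[OF l(1)] by (simp add: l field_simps)
    next
      \<comment> \<open>The kernel says nothing about null paths, but then both sides
        vanish.\<close>
      case False
      then have "prob {w \<in> space M. L w = l} = 0"
        by (simp add: zero_less_measure_iff)
      moreover have "prob {w \<in> space M. X (Suc n) w = j \<and> L w = l} \<le> prob {w \<in> space M. L w = l}"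
        using that by (intro finite_measure_mono) auto
      ultimately show ?thesis
        by (simp add: measure_le_0_iff)
    qed
    then show ?thesis
      by (simp add: emeasure_eq_measure ennreal_mult)
  qed
  \<comment> \<open>\<open>S\<close> may be infinite, so the sum over paths is an integral over
    \<open>count_space S\<close>; in \<open>ennreal\<close> no summability has to be
    checked.\<close>
  have "emeasure M {w \<in> space M. X (Suc n) w = j \<and> L w \<in> S} =
      emeasure M (\<Union>l\<in>S. {w \<in> space M. X (Suc n) w = j \<and> L w = l})"
    by (rule arg_cong[where f = "emeasure M"]) auto
  also have "\<dots> = (\<integral>\<^sup>+l. emeasure M {w \<in> space M. X (Suc n) w = j \<and> L w = l} \<partial>count_space S)"
    by (rule emeasure_UN_countable) (auto simp: disjoint_family_on_def)
  also have "\<dots> = (\<integral>\<^sup>+l. emeasure M {w \<in> space M. L w = l} * ennreal (pmf (K i) j) \<partial>count_space S)"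
    by (rule nn_integral_cong) (simp add: one)
  also have "\<dots> = (\<integral>\<^sup>+l. emeasure M {w \<in> space M. L w = l} \<partial>count_space S) * ennreal (pmf (K i) j)"
    by (rule nn_integral_multc) simp
  also have "(\<integral>\<^sup>+l. emeasure M {w \<in> space M. L w = l} \<partial>count_space S) =
      emeasure M (\<Union>l\<in>S. {w \<in> space M. L w = l})"
    by (rule emeasure_UN_countable[symmetric]) (auto simp: disjoint_family_on_def)
  also have "(\<Union>l\<in>S. {w \<in> space M. L w = l}) = {w \<in> space M. L w \<in> S}"
    by auto
  finally have "prob {w \<in> space M. X (Suc n) w = j \<and> L w \<in> S} =
      prob {w \<in> space M. L w \<in> S} * pmf (K i) j"
    by (simp add: emeasure_eq_measure flip: ennreal_mult)
  then show ?thesis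
    unfolding L_S unfolding L_def .
qed

section \<open>Crossing times and their symmetry under reflection\<close>

primrec crossing_time :: "(nat \<Rightarrow> real) \<Rightarrow> nat \<Rightarrow> real" where
  "crossing_time \<omega> 0 = 1"
| "crossing_time \<omega> (Suc i) = (1 + (1 - \<omega> (Suc i)) * crossing_time \<omega> i) / \<omega> (Suc i)"

lemma crossing_time_nonneg:
  assumes "\<And>k. k \<in> {1..i} \<Longrightarrow> \<omega> k \<in> {0<..1}"
  shows "crossing_time \<omega> i \<ge> 0"
  using assms
proof (induction i)
  case (Suc i)
  have "\<omega> (Suc i) \<in> {0<..1}" by (rule Suc.prems) simp
  moreover have "crossing_time \<omega> i \<ge> 0" by (rule Suc.IH) (rule Suc.prems, simp)
  ultimately show ?case by simp
qed simp

text \<open>As \<open>1 / \<omega> i = 1 + r i\<close>, the recursion for \<open>d\<close> reads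
  \<open>d i = 1 + r i + r i * d (i - 1)\<close>. The explicit \<open>r i\<close> and the one
  produced by the constant 1 in \<open>d (i - 1)\<close> together give the factor 2.\<close>

lemma crossing_time_eq:
  assumes "\<And>k. k \<in> {1..i} \<Longrightarrow> \<omega> k \<noteq> 0"
  shows "crossing_time \<omega> i = 1 + 2 * (\<Sum>j\<in>{1..i}. \<Prod>l\<in>{j..i}. (1 - \<omega> l) / \<omega> l)"
  using assms
proof (induction i)
  case (Suc i)
  define r where "r l = (1 - \<omega> l) / \<omega> l" for l
  have nz: "\<omega> (Suc i) \<noteq> 0" by (rule Suc.prems) simp
  have IH: "crossing_time \<omega> i = 1 + 2 * (\<Sum>j\<in>{1..i}. \<Prod>l\<in>{j..i}. r l)"
    unfolding r_def by (rule Suc.IH) (rule Suc.prems, simp)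
  have "(\<Sum>j\<in>{1..Suc i}. \<Prod>l\<in>{j..Suc i}. r l) = (\<Sum>j\<in>{1..i}. \<Prod>l\<in>{j..Suc i}. r l) + r (Suc i)"
    by simp
  also have "(\<Sum>j\<in>{1..i}. \<Prod>l\<in>{j..Suc i}. r l) = (\<Sum>j\<in>{1..i}. \<Prod>l\<in>{j..i}. r l) * r (Suc i)"
    by (simp add: sum_distrib_left mult.commute)
  finally have "1 + 2 * (\<Sum>j\<in>{1..Suc i}. \<Prod>l\<in>{j..Suc i}. r l) =
      1 + r (Suc i) + r (Suc i) * crossing_time \<omega> i"
    unfolding IH by (simp add: algebra_simps)
  also have "\<dots> = crossing_time \<omega> (Suc i)"
    using nz by (simp add: r_def field_simps)
  finally show ?case by (simp add: r_def)
qed simp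

text \<open>Summing over \<open>i\<close> yields one product for each nonempty interval
  \<open>{j..i}\<close> inside \<open>{1..N - 1}\<close>, and the reflection permutes these
  intervals.\<close>

lemma sum_crossing_time_reflect:
  assumes nz: "\<And>i. i \<in> {1..N - 1} \<Longrightarrow> \<omega> i \<noteq> 0"
    and refl: "\<And>i. i \<in> {1..N - 1} \<Longrightarrow> \<omega>' i = \<omega> (N - i)"
  shows "(\<Sum>i<N. crossing_time \<omega>' i) = (\<Sum>i<N. crossing_time \<omega> i)"
proof -
  define T where "T = (SIGMA i:{..<N}. {1..i})"
  have T: "p \<in> T \<longleftrightarrow> 1 \<le> snd p \<and> snd p \<le> fst p \<and> fst p < N" for p
    by (cases p) (auto simp: T_def)
  have *: "(\<Sum>i<N. crossing_time v i) =
      real N + 2 * (\<Sum>(i, j)\<in>T. \<Prod>l\<in>{j..i}. (1 - v l) / v l)"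
    if "\<And>i. i \<in> {1..N - 1} \<Longrightarrow> v i \<noteq> 0" for v
  proof -
    have "(\<Sum>i<N. crossing_time v i) =
        (\<Sum>i<N. 1 + 2 * (\<Sum>j\<in>{1..i}. \<Prod>l\<in>{j..i}. (1 - v l) / v l))"
      using that by (intro sum.cong refl crossing_time_eq) auto
    then show ?thesis
      by (simp add: T_def sum.distrib sum.Sigma flip: sum_distrib_left)
  qed
  have "(\<Sum>(i, j)\<in>T. \<Prod>l\<in>{j..i}. (1 - \<omega>' l) / \<omega>' l) =
      (\<Sum>(i, j)\<in>T. \<Prod>l\<in>{j..i}. (1 - \<omega> l) / \<omega> l)"
  \<comment> \<open>Reflection reverses order, so the endpoints trade places; the map is its own
    inverse.\<close>
  proof (rule sum.reindex_bij_witness[where i = "\<lambda>(i, j). (N - j, N - i)"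
        and j = "\<lambda>(i, j). (N - j, N - i)"])
    fix p assume "p \<in> T"
    then obtain i j where p: "p = (i, j)" and ij: "1 \<le> j" "j \<le> i" "i < N"
      by (cases p) (auto simp: T)
    have "(\<Prod>l\<in>{j..i}. (1 - \<omega>' l) / \<omega>' l) = (\<Prod>l\<in>{N - i..N - j}. (1 - \<omega> l) / \<omega> l)"
      by (rule prod.reindex_bij_witness[where i = "\<lambda>l. N - l" and j = "\<lambda>l. N - l"])
        (use ij in \<open>auto simp: refl\<close>)
    then show "(case case p of (i, j) \<Rightarrow> (N - j, N - i) of (i, j) \<Rightarrow> \<Prod>l\<in>{j..i}. (1 - \<omega> l) / \<omega> l) =
        (case p of (i, j) \<Rightarrow> \<Prod>l\<in>{j..i}. (1 - \<omega>' l) / \<omega>' l)"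
      by (simp add: p)
  qed (auto simp: T)
  moreover have "\<omega>' i \<noteq> 0" if "i \<in> {1..N - 1}" for i
    using that by (subst refl) (auto intro!: nz)
  ultimately show ?thesis
    using *[of \<omega>] *[of \<omega>'] nz by presburger
qed

section \<open>The expected hitting time as a sum of tail probabilities\<close>

lemma expected_hitting_time_eq_suminf:
  assumes X[measurable]: "\<And>n. X n \<in> measurable M (count_space UNIV)"
  shows "expected_hitting_time M X s = (\<Sum>n. emeasure M {w \<in> space M. \<forall>k\<le>n. X k w \<noteq> s})"
proof -
  have less: "enat n < hitting_time X s w \<longleftrightarrow> (\<forall>k\<le>n. X k w \<noteq> s)" for n w
  proof -
    have "enat n < hitting_time X s w \<longleftrightarrow> enat (Suc n) \<le> hitting_time X s w"
      by (metis Suc_ile_eq)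
    also have "\<dots> \<longleftrightarrow> (\<forall>k. X k w = s \<longrightarrow> n < k)"
      by (simp add: hitting_time_def le_INF_iff Suc_le_eq)
    also have "\<dots> \<longleftrightarrow> (\<forall>k\<le>n. X k w \<noteq> s)" by (metis linorder_not_le)
    finally show ?thesis .
  qed
  \<comment> \<open>This form serves measurability: in the definition the infimum ranges over a set
    that depends on \<open>w\<close>.\<close>
  have hit: "hitting_time X s w = (if \<exists>n. X n w = s then enat (LEAST n. X n w = s) else \<infinity>)" for w
  proof (cases "\<exists>n. X n w = s")
    case True
    then have "X (LEAST n. X n w = s) w = s" by (rule LeastI_ex)
    then show ?thesis
      using True unfolding hitting_time_def
      by (auto intro!: antisym INF_lower INF_greatest Least_le)
  qed (simp add: hitting_time_def top_enat_def)
  have "hitting_time X s \<in> measurable M (count_space UNIV)"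
    by (subst hit[abs_def]) measurable
  then show ?thesis
    unfolding expected_hitting_time_def
    by (subst nn_integral_enat_function) (simp_all add: less)
qed

section \<open>The expected hitting time as a sum of crossing times\<close>

lemma expected_hitting_time_origin_reflecting_walk:
  assumes N: "N \<ge> 1"
    and \<omega>: "\<And>i. i \<in> {1..N - 1} \<Longrightarrow> \<omega> i \<in> {0<..1}"
    and walk: "origin_reflecting_walk N \<omega> 0 M X"
  shows "expected_hitting_time M X N = ennreal (\<Sum>i<N. crossing_time \<omega> i)"
proof -
  from walk obtain K where K: "walk_kernel N \<omega> K" and mc: "markov_chain K 0 M X"
    by (auto simp: origin_reflecting_walk_def)
  interpret prob_space M using mc by (simp add: markov_chain_def)
  have X[measurable]: "X n \<in> measurable M (count_space UNIV)" for n
    using mc by (simp add: markov_chain_def)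
  have X0: "AE w in M. X 0 w = 0" using mc by (simp add: markov_chain_def)
  \<comment> \<open>The chain lives on all naturals, so survival is phrased as staying below
    \<open>N\<close>; \<open>below\<close> shows that this agrees almost surely with avoiding
    \<open>N\<close>. \<open>u n\<close> is the law at time \<open>n\<close> of the walk killed on
    leaving \<open>{..<N}\<close>.\<close>
  define A where "A n = {w \<in> space M. \<forall>k\<le>n. X k w < N}" for n
  define u where "u n i = prob {w \<in> space M. X n w = i \<and> (\<forall>k\<le>n. X k w < N)}" for n i
  have A_meas[measurable]: "A n \<in> sets M" for n unfolding A_def by measurable
  have step: "prob {w \<in> space M. X (Suc n) w = j \<and> X n w = i \<and> (\<forall>k\<le>n. X k w < N)} =
      u n i * pmf (K i) j" for n i j
  proof -
    have "(\<forall>x\<in>set (map (\<lambda>k. X k w) [0..<Suc n]). x < N) \<longleftrightarrow> (\<forall>k\<le>n. X k w < N)" for w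
      by (auto simp: less_Suc_eq_le simp del: upt_Suc)
    then show ?thesis
      using markov_chain_step[OF mc, of n j i "\<lambda>l. \<forall>x\<in>set l. x < N"]
      by (simp only: u_def)
  qed
  have split_step: "prob {w \<in> space M. X (Suc n) w = j \<and> (\<forall>k\<le>n. X k w < N)} =
      (\<Sum>i<N. u n i * pmf (K i) j)" for n j
  proof -
    have "{w \<in> space M. X (Suc n) w = j \<and> (\<forall>k\<le>n. X k w < N)} =
        (\<Union>i<N. {w \<in> space M. X (Suc n) w = j \<and> X n w = i \<and> (\<forall>k\<le>n. X k w < N)})"
      by auto
    also have "prob \<dots> = (\<Sum>i<N. prob {w \<in> space M. X (Suc n) w = j \<and> X n w = i \<and> (\<forall>k\<le>n. X k w < N)})"
      by (rule finite_measure_finite_Union) (auto simp: disjoint_family_on_def)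
    finally show ?thesis by (simp only: step)
  qed
  have prob_A: "prob (A n) = (\<Sum>i<N. u n i)" for n
  proof -
    have "A n = (\<Union>i<N. {w \<in> space M. X n w = i \<and> (\<forall>k\<le>n. X k w < N)})"
      by (auto simp: A_def)
    also have "prob \<dots> = (\<Sum>i<N. prob {w \<in> space M. X n w = i \<and> (\<forall>k\<le>n. X k w < N)})"
      by (rule finite_measure_finite_Union) (auto simp: disjoint_family_on_def)
    finally show ?thesis by (simp only: u_def)
  qed
  have u_Suc: "u (Suc n) j = (\<Sum>i<N. u n i * pmf (K i) j)" if "j < N" for n j
  proof -
    have "u (Suc n) j = prob {w \<in> space M. X (Suc n) w = j \<and> (\<forall>k\<le>n. X k w < N)}"
      unfolding u_def by (rule arg_cong[where f = prob]) (use that in \<open>auto simp: le_Suc_eq\<close>)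
    then show ?thesis by (simp add: split_step)
  qed
  have Kpos: "pmf (K i) (i + 1) = \<omega> i" "pmf (K i) (i - 1) = 1 - \<omega> i" if "0 < i" "i < N" for i
    using K that by (auto simp: walk_kernel_def)
  have K0: "K 0 = return_pmf 1"
  proof -
    have "measure_pmf.prob (K 0) {1} = 1"
      using K by (simp add: walk_kernel_def measure_pmf_single)
    then have "set_pmf (K 0) \<subseteq> {1}"
      by (auto simp: measure_pmf.prob_eq_1 AE_measure_pmf_iff)
    then show ?thesis by (simp add: set_pmf_subset_singleton)
  qed
  \<comment> \<open>The two prescribed probabilities already add up to 1, leaving no mass for a
    third point.\<close>
  have supp: "pmf (K i) j = 0" if i: "0 < i" "i < N" and j: "j \<noteq> i + 1" "j \<noteq> i - 1" for i j
  proof -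
    have "(\<Sum>k\<in>{i + 1, i - 1, j}. pmf (K i) k) \<le> 1"
      by (simp add: measure_pmf.prob_le_1 flip: measure_measure_pmf_finite)
    then show ?thesis using Kpos[OF i] i j pmf_nonneg[of "K i" j] by simp
  qed
  have no_jump: "AE w in M. \<not> (X (Suc n) w = j \<and> (\<forall>k\<le>n. X k w < N))" if "j > N" for n j
  proof -
    have "pmf (K i) j = 0" if "i < N" for i
      using \<open>j > N\<close> that supp[of i j] by (cases "i = 0") (auto simp: K0)
    then have "prob {w \<in> space M. X (Suc n) w = j \<and> (\<forall>k\<le>n. X k w < N)} = 0"
      by (simp add: split_step)
    then show ?thesis
      by (subst AE_iff_measurable[OF _ refl]) (simp_all add: emeasure_eq_measure)
  qed
  have below: "AE w in M. (\<forall>k\<le>n. X k w \<noteq> N) \<longleftrightarrow> (\<forall>k\<le>n. X k w < N)" for n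
  proof -
    \<comment> \<open>Countably many forbidden jumps share one null set; off it, a path starting at
      0 cannot get above \<open>N\<close> without visiting \<open>N\<close>.\<close>
    have "AE w in M. \<forall>n j. N < j \<longrightarrow> \<not> (X (Suc n) w = j \<and> (\<forall>k\<le>n. X k w < N))"
      unfolding AE_all_countable by (intro allI AE_impI no_jump)
    with X0 show ?thesis
    proof eventually_elim
      case (elim w)
      have "(\<forall>k\<le>n. X k w \<noteq> N) \<Longrightarrow> (\<forall>k\<le>n. X k w < N)"
        by (induction n) (use elim N in \<open>auto simp: le_Suc_eq linorder_neq_iff\<close>)
      then show ?case by auto
    qed
  qed
  have expected: "expected_hitting_time M X N = (\<Sum>n. ennreal (prob (A n)))"
    unfolding expected_hitting_time_eq_suminf[OF X]
  proof (rule suminf_cong)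
    fix n
    have "emeasure M {w \<in> space M. \<forall>k\<le>n. X k w \<noteq> N} = emeasure M (A n)"
      by (rule emeasure_eq_AE) (use below[of n] in \<open>auto simp: A_def\<close>)
    then show "emeasure M {w \<in> space M. \<forall>k\<le>n. X k w \<noteq> N} = ennreal (prob (A n))"
      by (simp add: emeasure_eq_measure)
  qed
  \<comment> \<open>\<open>h i = 0\<close> for \<open>i \<ge> N\<close>, so mass that reaches
    \<open>N\<close> drops out of all sums below.\<close>
  define h where "h i = (\<Sum>k\<in>{i..<N}. crossing_time \<omega> k)" for i
  have h_Suc: "h i = crossing_time \<omega> i + h (Suc i)" if "i < N" for i
    using that by (simp add: h_def sum.atLeast_Suc_lessThan)
  have c_nonneg: "crossing_time \<omega> i \<ge> 0" if "i < N" for i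
    by (intro crossing_time_nonneg \<omega>) (use that in auto)
  have h_nonneg: "h i \<ge> 0" for i
    unfolding h_def by (intro sum_nonneg c_nonneg) auto
  have h_le: "h i \<le> h 0" for i
    unfolding h_def by (intro sum_mono2 c_nonneg) auto
  have u_nonneg: "u n i \<ge> 0" for n i by (simp add: u_def)
  have h_step: "(\<Sum>j<N. pmf (K i) j * h j) = h i - 1" if i: "i < N" for i
  proof (cases i)
    case 0
    have "(\<Sum>j<N. pmf (K 0) j * h j) = (\<Sum>j\<in>{..<N}. if j = 1 then h 1 else 0)"
      by (rule sum.cong) (auto simp: K0)
    \<comment> \<open>If \<open>N = 1\<close>, the index 1 is outside the range, but then
      \<open>h 1 = 0\<close>.\<close>
    also have "\<dots> = h 1" by (simp add: h_def)
    also have "\<dots> = h 0 - 1" using h_Suc[of 0] N by simp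
    finally show ?thesis using 0 by simp
  next
    case (Suc m)
    have w: "\<omega> i > 0" using \<omega>[of i] i Suc by auto
    \<comment> \<open>Adding the zero term at \<open>N\<close> keeps the upper neighbour in range
      when \<open>i = N - 1\<close>.\<close>
    have "(\<Sum>j<N. pmf (K i) j * h j) = (\<Sum>j\<in>{..N}. pmf (K i) j * h j)"
      by (simp add: h_def flip: lessThan_Suc_atMost)
    also have "\<dots> = (\<Sum>j\<in>{m, Suc i}. pmf (K i) j * h j)"
      by (rule sum.mono_neutral_right) (use i Suc supp[of i] in auto)
    also have "\<dots> = (1 - \<omega> i) * h m + \<omega> i * h (Suc i)"
      using Kpos[of i] i Suc by simp
    also have "\<dots> = h i + (1 - \<omega> i) * crossing_time \<omega> m - \<omega> i * crossing_time \<omega> i"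
      using h_Suc[of m] h_Suc[of i] i Suc by (simp add: algebra_simps del: crossing_time.simps)
    \<comment> \<open>This is the recursion
      \<open>\<omega> i * d i = 1 + (1 - \<omega> i) * d m\<close> for
      \<open>d = crossing_time \<omega>\<close>.\<close>
    also have "\<dots> = h i - 1"
      using w Suc by simp
    finally show ?thesis .
  qed
  define V where "V n = (\<Sum>i<N. u n i * h i)" for n
  have V_Suc: "V (Suc n) = V n - prob (A n)" for n
  proof -
    have "V (Suc n) = (\<Sum>j<N. \<Sum>i<N. u n i * pmf (K i) j * h j)"
      by (simp add: V_def u_Suc sum_distrib_right)
    also have "\<dots> = (\<Sum>i<N. u n i * (\<Sum>j<N. pmf (K i) j * h j))"
      by (subst sum.swap) (simp add: sum_distrib_left mult.assoc)
    also have "\<dots> = (\<Sum>i<N. u n i * (h i - 1))"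
      by (simp add: h_step)
    finally show ?thesis
      by (simp add: V_def prob_A algebra_simps sum_subtractf)
  qed
  have V0: "V 0 = h 0"
  proof -
    have "u 0 i = (if i = 0 then 1 else 0)" for i
    proof -
      have "u 0 i = prob {w \<in> space M. i = 0}"
        unfolding u_def by (rule finite_measure_eq_AE) (use X0 N in auto)
      then show ?thesis by (simp add: prob_space)
    qed
    then show ?thesis using N by (simp add: V_def if_distrib[of "\<lambda>x. x * _"] cong: if_cong)
  qed
  have partial: "(\<Sum>m<n. prob (A m)) = h 0 - V n" for n
    by (induction n) (simp_all add: V0 V_Suc)
  have V_nonneg: "V n \<ge> 0" for n
    unfolding V_def by (intro sum_nonneg mult_nonneg_nonneg u_nonneg h_nonneg)
  have "summable (\<lambda>n. prob (A n))"
    by (rule summableI_nonneg_bounded[where x = "h 0"]) (use V_nonneg in \<open>auto simp: partial\<close>)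
  then have lim: "(\<lambda>n. prob (A n)) \<longlonglongrightarrow> 0"
    by (rule summable_LIMSEQ_zero)
  have "V \<longlonglongrightarrow> 0"
  proof (rule tendsto_sandwich)
    show "\<forall>\<^sub>F n in sequentially. 0 \<le> V n" by (simp add: V_nonneg)
    \<comment> \<open>\<open>h\<close> is largest at 0, so \<open>V\<close> is controlled by the
      survival probability.\<close>
    show "\<forall>\<^sub>F n in sequentially. V n \<le> prob (A n) * h 0"
      by (auto simp: V_def prob_A sum_distrib_right intro!: always_eventually sum_mono mult_left_mono h_le u_nonneg)
    show "(\<lambda>n. prob (A n) * h 0) \<longlonglongrightarrow> 0"
      using tendsto_mult_left_zero[OF lim] by simp
  qed simp
  then have "(\<lambda>n. prob (A n)) sums h 0"
    unfolding sums_def partial using tendsto_diff[OF tendsto_const[of "h 0"]] by fastforce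
  then have "(\<Sum>n. ennreal (prob (A n))) = ennreal (h 0)"
    by (intro suminf_ennreal_eq) auto
  then show ?thesis
    by (simp add: expected h_def atLeast0LessThan)
qed

theorem corollary2:
  fixes N :: nat and \<omega> \<omega>' :: "nat \<Rightarrow> real"
    and M :: "'a measure" and X :: "nat \<Rightarrow> 'a \<Rightarrow> nat"
    and M' :: "'b measure" and X' :: "nat \<Rightarrow> 'b \<Rightarrow> nat"
  assumes "N \<ge> 1"
    and "\<And>i. i \<in> {1..N - 1} \<Longrightarrow> \<omega> i \<in> {0<..1}"
    and "\<And>i. i \<in> {1..N - 1} \<Longrightarrow> \<omega>' i = \<omega> (N - i)"
    and "origin_reflecting_walk N \<omega> 0 M X"
    and "origin_reflecting_walk N \<omega>' 0 M' X'"
  shows "expected_hitting_time M' X' N = expected_hitting_time M X N"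
proof -
  have "\<omega>' i \<in> {0<..1}" if "i \<in> {1..N - 1}" for i
    using that assms(2)[of "N - i"] assms(3)[of i] by force
  moreover have "(\<Sum>i<N. crossing_time \<omega>' i) = (\<Sum>i<N. crossing_time \<omega> i)"
    by (rule sum_crossing_time_reflect) (use assms(2,3) in force)+
  ultimately show ?thesis
    using expected_hitting_time_origin_reflecting_walk[OF assms(1,2,4)]
      expected_hitting_time_origin_reflecting_walk[OF assms(1) _ assms(5)] by simp
qed

end
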